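(* Let $(\Omega,\mathcal B_\otimes)$ be a measurable space with $\Omega\neq\emptyset$ such that there is an isomorphism of measurable spaces $$\Theta:(\Omega,\mathcal B_\otimes)\cong(\Omega\times\Omega,\mathcal B_\otimes\otimes\mathcal B_\otimes).$$ Let $\mathsf P\subseteq\mathsf G(\Omega,\mathcal B_\otimes)$ be a non-empty subset such that: (a) if $P\in\mathsf P$ and $\Phi:(\Omega,(\mathcal B_\otimes)_{\mathsf P})\to(\Omega,\mathcal B_\otimes)$ is measurable, then the restriction to $\mathcal B_\otimes$ of the push-forward $\Phi_*\bar P$ lies in $\mathsf P$; (b) if $P_1,P_2\in\mathsf P$, then $\Theta^{-1}_*(P_1\otimes P_2)|_{\mathcal B_\otimes}\in\mathsf P$. Here $P\in\mathsf P$ is identified with its unique completion $\bar P$ living on $(\mathcal B_\otimes)_P\supseteq(\mathcal B_\otimes)_{\mathsf P}$. Put $\mathcal B_\Omega:=(\mathcal B_\otimes)_{\mathsf P}$ and let $\Omega^\Omega$ be the set of all measurable maps $(\Omega,\mathcal B_\Omega)\to(\Omega,\mathcal B_\Omega)$. Then $(\Omega,\Omega^\Omega,\mathcal B_\Omega,\mathsf P)$ is a sample space with product-compatible probability measures, it satisfies the Fubini property, and there is an isomorphism of quasi-measurable spaces $\Omega\cong\Omega\times\Omega$. Furthermore, $\mathcal B_\Omega$ is $\mathsf P(\Omega)$-complete, and $$\mathcal F(\mathcal B_\otimes)=\mathcal F(\mathcal B_\Omega)=\Omega^\Omega,\qquad \mathcal B_{\Omega\times\Omega}=(\mathcal B_\Omega\otimes\mathcal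 B_\Omega)_{\mathsf P(\Omega\times\Omega)}.$$
   Context: $\mathsf G(\Omega,\mathcal B)$ is the set of all probability measures on $(\Omega,\mathcal B)$. For a set $\mathcal Q\neq\emptyset$ of probability measures whose domains contain the $\sigma$-algebra $\mathcal B$, the $\mathcal Q$-completion is $(\mathcal B)_{\mathcal Q}:=\bigcap_{Q\in\mathcal Q}(\mathcal B)_Q$, where $(\mathcal B)_Q$ is the Lebesgue completion of $\mathcal B$ w.r.t. $Q|_{\mathcal B}$; $\mathcal B$ is $\mathcal Q$-complete if $\mathcal B=(\mathcal B)_{\mathcal Q}$. For a $\sigma$-algebra $\mathcal B$ on a set $\mathcal X$, $\mathcal F(\mathcal B)$ is the set of all measurable maps $(\Omega,\mathcal B_\Omega)\to(\mathcal X,\mathcal B)$. Sample space with product-compatible probability measures $(\Omega,\Omega^\Omega,\mathcal B_\Omega,\mathsf P)$: $\Omega\neq\emptyset$; $\Omega^\Omega$ is a set of maps $\Omega\to\Omega$ containing the identity and all constants and closed under composition; every $\Phi\in\Omega^\Omega$ is $\mathcal B_\Omega$-$\mathcal B_\Omega$-measurable; $\mathsf P$ is a non-empty set of probability measures $P$ on $\Omega$, each with its own domain $\sigma$-algebra $\mathcal B_P$, such that (i) $\Phi^{-1}(D)\in\mathcal B_P$ for all $\Phi\in\Omega^\Omega$, $P\in\mathsf P$, $D\in\mathcal B_\Omega$; (ii) for $D\in\mathcal B_{\Omega\times\Omega}$, $P\in\mathsf P$ the map $\omega\mapsto P(D^\omega)$ is $\mathcal B_\Omega$-measurable; (iii)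 for $P_1,P_2\in\mathsf P$ there are $P\in\mathsf P$ and $\Phi=(\Phi_1,\Phi_2)$, $\Phi_i\in\Omega^\Omega$, with $\int P_1(D^{\omega_2})P_2(d\omega_2)=P(\Phi^{-1}(D))$ for all $D\in\mathcal B_{\Omega\times\Omega}$. Here $D^{\omega_2}=\{\omega_1\mid(\omega_1,\omega_2)\in D\}$, $D_{\omega_1}=\{\omega_2\mid(\omega_1,\omega_2)\in D\}$, and $$\mathcal B_{\Omega\times\Omega}=\{D\subseteq\Omega\times\Omega\mid(\Phi_1,\Phi_2)^{-1}(D)\in\mathcal B_\Omega\ \forall\Phi_1,\Phi_2\in\Omega^\Omega\}.$$ In the claim the domain of $P\in\mathsf P$ as a member of the sample space is that of its completion, $(\mathcal B_\otimes)_P$. Fubini property: $\int P_2(D_{\omega_1})P_1(d\omega_1)=\int P_1(D^{\omega_2})P_2(d\omega_2)$ for all $P_1,P_2\in\mathsf P$, $D\in\mathcal B_{\Omega\times\Omega}$. A quasi-measurable space is a pair $(\mathcal X,\mathcal X^\Omega)$ with $\mathcal X^\Omega$ a set of maps $\Omega\to\mathcal X$ containing the constants and closed under precomposition with $\Omega^\Omega$; $g:\mathcal X\to\mathcal Y$ is quasi-measurable if $g\circ\mathcal X^\Omega\subseteq\mathcal Y^\Omega$; $\Omega\times\Omega$ carries $\Omega^\Omega\times\Omega^\Omega$. $\mathsf P(\Omega)$ is the set of push-forwards $\Phi_*P$ (restricted to $\mathcal B_\Omega$), $P\in\mathsf P$, $\Phi\in\Omega^\Omega$; $\mathsf P(\Omega\times\Omega)$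 is the set of push-forwards $(\Phi_1,\Phi_2)_*P$ (restricted to $\mathcal B_{\Omega\times\Omega}$), $P\in\mathsf P$, $\Phi_1,\Phi_2\in\Omega^\Omega$. *)

theory Defs
  imports "HOL-Probability.Probability"
begin

section \<open>Measurable spaces and maps\<close>

text \<open>
  A measurable space is given by the \<open>space\<close> and \<open>sets\<close> of a \<^typ>\<open>'a measure\<close>; its measure
  is irrelevant. A set of maps \<open>X \<rightarrow> Y\<close> is a set of extensional functions, a subset of
  \<open>X \<rightarrow>\<^sub>E Y\<close>, so that equality of sets of maps only concerns values on \<open>X\<close>.
\<close>

definition measurable_maps :: "'a measure \<Rightarrow> 'b measure \<Rightarrow> ('a \<Rightarrow> 'b) set" where
  "measurable_maps M N = measurable M N \<inter> (space M \<rightarrow>\<^sub>E space N)"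

definition measurable_iso :: "'a measure \<Rightarrow> 'b measure \<Rightarrow> ('a \<Rightarrow> 'b) \<Rightarrow> bool" where
  "measurable_iso M N f \<longleftrightarrow>
     bij_betw f (space M) (space N) \<and>
     f \<in> measurable M N \<and> the_inv_into (space M) f \<in> measurable N M"


section \<open>Completion with respect to a set of measures\<close>

text \<open>
  The measures in \<open>Q\<close> may live on different \<open>\<sigma>\<close>-algebras, all containing that of \<open>B\<close>;
  \<^term>\<open>restr_to_subalg q B\<close> is the restriction of \<open>q\<close> to \<^term>\<open>sets B\<close>.
  Meaningful for \<^prop>\<open>Q \<noteq> {}\<close> only.
\<close>

definition completion_sets :: "'a measure \<Rightarrow> 'a measure set \<Rightarrow> 'a set set" where
  "completion_sets B Q = (\<Inter>q\<in>Q. sets (completion (restr_to_subalg q B)))"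

definition completion_space :: "'a measure \<Rightarrow> 'a measure set \<Rightarrow> 'a measure" where
  "completion_space B Q = sigma (space B) (completion_sets B Q)"

definition complete_wrt :: "'a measure \<Rightarrow> 'a measure set \<Rightarrow> bool" where
  "complete_wrt B Q \<longleftrightarrow> sets B = completion_sets B Q"

lemma sigma_algebra_completion_sets:
  assumes "Q \<noteq> {}" and "\<And>q. q \<in> Q \<Longrightarrow> subalgebra q B"
  shows "sigma_algebra (space B) (completion_sets B Q)"
proof -
  have 1: "sigma_algebra (space B) (sets (completion (restr_to_subalg q B)))" if "q \<in> Q" for q
  proof -
    have "space (completion (restr_to_subalg q B)) = space B"
      using assms(2)[OF that] by (simp add: space_restr_to_subalg subalgebra_def)
    then show ?thesis
      by (metis sets.sigma_algebra_axioms)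
  qed
  let ?C = "\<lambda>q. sets (completion (restr_to_subalg q B))"
  obtain q0 where "q0 \<in> Q" using assms(1) by blast
  show ?thesis
    unfolding completion_sets_def sigma_algebra_iff2
  proof (intro conjI ballI allI impI INT_I)
    have "?C q0 \<subseteq> Pow (space B)"
      using 1[OF \<open>q0 \<in> Q\<close>] unfolding sigma_algebra_iff2 by blast
    then show "(\<Inter>q\<in>Q. ?C q) \<subseteq> Pow (space B)"
      using \<open>q0 \<in> Q\<close> by blast
  next
    fix q s assume "q \<in> Q" "s \<in> (\<Inter>q\<in>Q. ?C q)"
    then have "s \<in> ?C q" by blast
    then show "space B - s \<in> ?C q"
      using 1[OF \<open>q \<in> Q\<close>] unfolding sigma_algebra_iff2 by blast
  next
    fix q and A :: "nat \<Rightarrow> 'a set" assume "q \<in> Q" "range A \<subseteq> (\<Inter>q\<in>Q. ?C q)"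
    then have "range A \<subseteq> ?C q" by blast
    then show "(\<Union>i. A i) \<in> ?C q" by (rule sets.countable_UN[where X=UNIV, simplified])
  qed simp
qed

lemma
  assumes "Q \<noteq> {}" and "\<And>q. q \<in> Q \<Longrightarrow> subalgebra q B"
  shows sets_completion_space: "sets (completion_space B Q) = completion_sets B Q"
    and space_completion_space: "space (completion_space B Q) = space B"
proof -
  interpret sigma_algebra "space B" "completion_sets B Q"
    using assms by (rule sigma_algebra_completion_sets)
  show "sets (completion_space B Q) = completion_sets B Q"
    "space (completion_space B Q) = space B"
    by (simp_all add: completion_space_def)
qed


section \<open>Sample spaces\<close>

text \<open>
  In \<open>(\<Omega>, \<Omega>\<^sup>\<Omega>, \<B>\<^sub>\<Omega>, P)\<close>, the set \<open>\<Omega>\<close> and the \<open>\<sigma>\<close>-algebra \<open>\<B>\<^sub>\<Omega>\<close> are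
  \<^term>\<open>space BO\<close> and \<^term>\<open>sets BO\<close>, and \<open>\<Omega>\<^sup>\<Omega>\<close> is \<open>Endo\<close>.
  Each measure in \<open>PP\<close> has its own domain.
\<close>

definition square_sets :: "('a \<Rightarrow> 'a) set \<Rightarrow> 'a measure \<Rightarrow> ('a \<times> 'a) set set" where
  "square_sets Endo BO =
     {D. D \<subseteq> space BO \<times> space BO \<and>
         (\<forall>\<Phi>1\<in>Endo. \<forall>\<Phi>2\<in>Endo. {\<omega> \<in> space BO. (\<Phi>1 \<omega>, \<Phi>2 \<omega>) \<in> D} \<in> sets BO)}"

definition square_space :: "('a \<Rightarrow> 'a) set \<Rightarrow> 'a measure \<Rightarrow> ('a \<times> 'a) measure" where
  "square_space Endo BO = sigma (space BO \<times> space BO) (square_sets Endo BO)"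

lemma sigma_algebra_square_sets:
  assumes "Endo \<subseteq> space BO \<rightarrow>\<^sub>E space BO"
  shows "sigma_algebra (space BO \<times> space BO) (square_sets Endo BO)"
  unfolding sigma_algebra_iff2
proof (intro conjI ballI allI impI)
  fix D assume D: "D \<in> square_sets Endo BO"
  have "{\<omega> \<in> space BO. (\<Phi>1 \<omega>, \<Phi>2 \<omega>) \<in> space BO \<times> space BO - D} \<in> sets BO"
    if "\<Phi>1 \<in> Endo" "\<Phi>2 \<in> Endo" for \<Phi>1 \<Phi>2
  proof -
    have "{\<omega> \<in> space BO. (\<Phi>1 \<omega>, \<Phi>2 \<omega>) \<in> space BO \<times> space BO - D} =
      space BO - {\<omega> \<in> space BO. (\<Phi>1 \<omega>, \<Phi>2 \<omega>) \<in> D}"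
      using assms that by (auto simp: PiE_iff subset_iff)
    then show ?thesis
      using D that by (auto simp: square_sets_def)
  qed
  then show "space BO \<times> space BO - D \<in> square_sets Endo BO"
    by (auto simp: square_sets_def)
next
  fix A :: "nat \<Rightarrow> ('a \<times> 'a) set" assume A: "range A \<subseteq> square_sets Endo BO"
  have "{\<omega> \<in> space BO. (\<Phi>1 \<omega>, \<Phi>2 \<omega>) \<in> (\<Union>i. A i)} \<in> sets BO"
    if "\<Phi>1 \<in> Endo" "\<Phi>2 \<in> Endo" for \<Phi>1 \<Phi>2
  proof -
    have "{\<omega> \<in> space BO. (\<Phi>1 \<omega>, \<Phi>2 \<omega>) \<in> (\<Union>i. A i)} =
      (\<Union>i. {\<omega> \<in> space BO. (\<Phi>1 \<omega>, \<Phi>2 \<omega>) \<in> A i})"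
      by auto
    moreover have "{\<omega> \<in> space BO. (\<Phi>1 \<omega>, \<Phi>2 \<omega>) \<in> A i} \<in> sets BO" for i
      using A that by (auto simp: square_sets_def)
    ultimately show ?thesis by auto
  qed
  then show "(\<Union>i. A i) \<in> square_sets Endo BO"
    using A unfolding square_sets_def by blast
qed (auto simp: square_sets_def)

lemma
  assumes "Endo \<subseteq> space BO \<rightarrow>\<^sub>E space BO"
  shows sets_square_space: "sets (square_space Endo BO) = square_sets Endo BO"
    and space_square_space: "space (square_space Endo BO) = space BO \<times> space BO"
proof -
  interpret sigma_algebra "space BO \<times> space BO" "square_sets Endo BO"
    using assms by (rule sigma_algebra_square_sets)
  show "sets (square_space Endo BO) = square_sets Endo BO"
    "space (square_space Endo BO) = space BO \<times> space BO"
    by (simp_all add: square_space_def)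
qed

text \<open>
  The integrals below are taken over measures whose domains may be larger than \<^term>\<open>sets BO\<close>;
  the integrands are \<open>BO\<close>-measurable by \<open>section_measurable\<close> (for sections in the other
  variable, because \<open>square_sets Endo BO\<close> is invariant under swapping the components).
\<close>

locale product_compatible_sample_space =
  fixes Endo :: "('a \<Rightarrow> 'a) set" and BO :: "'a measure" and PP :: "'a measure set"
  assumes nonempty: "space BO \<noteq> {}"
    and maps: "Endo \<subseteq> space BO \<rightarrow>\<^sub>E space BO"
    and identity: "(\<lambda>\<omega>\<in>space BO. \<omega>) \<in> Endo"
    and constants: "\<And>c. c \<in> space BO \<Longrightarrow> (\<lambda>\<omega>\<in>space BO. c) \<in> Endo"
    and composition: "\<And>\<Phi> \<Psi>. \<Phi> \<in> Endo \<Longrightarrow> \<Psi> \<in> Endo \<Longrightarrow> compose (space BO) \<Phi> \<Psi> \<in> Endo"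
    and measurable: "\<And>\<Phi>. \<Phi> \<in> Endo \<Longrightarrow> \<Phi> \<in> measurable BO BO"
    and PP_nonempty: "PP \<noteq> {}"
    and PP_prob: "\<And>P. P \<in> PP \<Longrightarrow> prob_space P \<and> space P = space BO"
    and preimage_sets: "\<And>\<Phi> P D. \<Phi> \<in> Endo \<Longrightarrow> P \<in> PP \<Longrightarrow> D \<in> sets BO \<Longrightarrow> \<Phi> -` D \<inter> space BO \<in> sets P"
    and section_measurable: "\<And>D P. D \<in> square_sets Endo BO \<Longrightarrow> P \<in> PP \<Longrightarrow>
      (\<lambda>\<omega>2. emeasure P {\<omega>1. (\<omega>1, \<omega>2) \<in> D}) \<in> borel_measurable BO"
    and product: "\<And>P1 P2. P1 \<in> PP \<Longrightarrow> P2 \<in> PP \<Longrightarrow>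
      \<exists>P\<in>PP. \<exists>\<Phi>1\<in>Endo. \<exists>\<Phi>2\<in>Endo. \<forall>D\<in>square_sets Endo BO.
        (\<integral>\<^sup>+\<omega>2. emeasure P1 {\<omega>1. (\<omega>1, \<omega>2) \<in> D} \<partial>P2) =
        emeasure P {\<omega> \<in> space BO. (\<Phi>1 \<omega>, \<Phi>2 \<omega>) \<in> D}"

definition fubini_property ::
  "('a \<Rightarrow> 'a) set \<Rightarrow> 'a measure \<Rightarrow> 'a measure set \<Rightarrow> bool" where
  "fubini_property Endo BO PP \<longleftrightarrow>
     (\<forall>P1\<in>PP. \<forall>P2\<in>PP. \<forall>D\<in>square_sets Endo BO.
        (\<integral>\<^sup>+\<omega>1. emeasure P2 {\<omega>2. (\<omega>1, \<omega>2) \<in> D} \<partial>P1) =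
        (\<integral>\<^sup>+\<omega>2. emeasure P1 {\<omega>1. (\<omega>1, \<omega>2) \<in> D} \<partial>P2))"

definition pushforwards ::
  "('a \<Rightarrow> 'a) set \<Rightarrow> 'a measure \<Rightarrow> 'a measure set \<Rightarrow> 'a measure set" where
  "pushforwards Endo BO PP = {distr P BO \<Phi> |P \<Phi>. P \<in> PP \<and> \<Phi> \<in> Endo}"

definition square_pushforwards ::
  "('a \<Rightarrow> 'a) set \<Rightarrow> 'a measure \<Rightarrow> 'a measure set \<Rightarrow> ('a \<times> 'a) measure set" where
  "square_pushforwards Endo BO PP =
     {distr P (square_space Endo BO) (\<lambda>\<omega>. (\<Phi>1 \<omega>, \<Phi>2 \<omega>)) |P \<Phi>1 \<Phi>2.
        P \<in> PP \<and> \<Phi>1 \<in> Endo \<and> \<Phi>2 \<in> Endo}"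


section \<open>Quasi-measurable spaces\<close>

definition quasi_measurable_space ::
  "'o set \<Rightarrow> ('o \<Rightarrow> 'o) set \<Rightarrow> 'x set \<Rightarrow> ('o \<Rightarrow> 'x) set \<Rightarrow> bool" where
  "quasi_measurable_space Om Endo X XO \<longleftrightarrow>
     XO \<subseteq> (Om \<rightarrow>\<^sub>E X) \<and>
     (\<forall>x\<in>X. (\<lambda>\<omega>\<in>Om. x) \<in> XO) \<and>
     (\<forall>\<alpha>\<in>XO. \<forall>\<Phi>\<in>Endo. compose Om \<alpha> \<Phi> \<in> XO)"

definition quasi_measurable ::
  "'o set \<Rightarrow> 'x set \<Rightarrow> ('o \<Rightarrow> 'x) set \<Rightarrow> 'y set \<Rightarrow> ('o \<Rightarrow> 'y) set \<Rightarrow> ('x \<Rightarrow> 'y) \<Rightarrow> bool" where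
  "quasi_measurable Om X XO Y YO g \<longleftrightarrow>
     g \<in> X \<rightarrow> Y \<and> (\<forall>\<alpha>\<in>XO. compose Om g \<alpha> \<in> YO)"

definition quasi_measurable_iso ::
  "'o set \<Rightarrow> ('o \<Rightarrow> 'o) set \<Rightarrow> 'x set \<Rightarrow> ('o \<Rightarrow> 'x) set \<Rightarrow> 'y set \<Rightarrow> ('o \<Rightarrow> 'y) set
    \<Rightarrow> ('x \<Rightarrow> 'y) \<Rightarrow> bool" where
  "quasi_measurable_iso Om Endo X XO Y YO g \<longleftrightarrow>
     quasi_measurable_space Om Endo X XO \<and> quasi_measurable_space Om Endo Y YO \<and>
     bij_betw g X Y \<and>
     quasi_measurable Om X XO Y YO g \<and>
     quasi_measurable Om Y YO X XO (the_inv_into X g)"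

text \<open>The set \<open>X\<^sup>\<Omega> \<times> Y\<^sup>\<Omega>\<close>, viewed as a set of maps \<open>\<Omega> \<rightarrow> X \<times> Y\<close>.\<close>

definition prod_maps ::
  "'o set \<Rightarrow> ('o \<Rightarrow> 'x) set \<Rightarrow> ('o \<Rightarrow> 'y) set \<Rightarrow> ('o \<Rightarrow> 'x \<times> 'y) set" where
  "prod_maps Om XO YO = {(\<lambda>\<omega>\<in>Om. (\<alpha> \<omega>, \<beta> \<omega>)) |\<alpha> \<beta>. \<alpha> \<in> XO \<and> \<beta> \<in> YO}"

end

theory Submission
  imports Defs
begin

text \<open>
  A measurable map \<open>f\<close> out of a complete measure space \<open>M\<close> stays measurable when its target is
  completed with respect to the push-forward of \<open>M\<close>. Since \<open>P\<close> is closed under push-forwards, this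
  gives \<open>\<F>(\<B>\<^sub>\<otimes>) = \<F>(\<B>\<^sub>\<Omega>)\<close>. Hence \<open>\<Theta>\<close> identifies \<open>\<B>\<^sub>\<Omega>\<close> with
  \<open>\<B>\<^bsub>\<Omega>\<times>\<Omega>\<^esub>\<close>, and, by closure under products, every set of the latter is measurable for the
  completion of each \<open>P\<^sub>1 \<otimes> P\<^sub>2\<close>. All statements about sections are then Fubini's theorem for
  completed product measures.
\<close>

section \<open>Completed measures\<close>

context complete_measure
begin

text \<open>The preimage of a null set of the push-forward is null in \<open>M\<close>, and
  completeness of \<open>M\<close> makes every subset of it measurable. Using
  \<open>distr M N f\<close> itself as target turns the null-set condition of
  \<open>measurable_completion2\<close> into an equality.\<close>

lemma measurable_completion_distr:
  assumes "f \<in> measurable M N"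
  shows "f \<in> measurable M (completion (distr M N f))"
proof (rule measurable_completion2)
  have "distr M (distr M N f) f = distr M N f"
    by (rule distr_cong) simp_all
  then show "null_sets (distr M N f) \<subseteq> null_sets (distr M (distr M N f) f)"
    by simp
qed (use assms in simp)

lemma completion_distr:
  assumes "f \<in> measurable M N"
  shows "completion (distr M N f) = distr M (completion (distr M N f)) f"
proof -
  have eq: "distr M (distr M N f) f = distr M N f"
    by (rule distr_cong) simp_all
  then show ?thesis
    using completion_distr_eq[of f "distr M N f"] assms by simp
qed

text \<open>The completed push-forward is again a push-forward along \<open>f\<close>, now regarded
  as a map into the completion, so the usual formula also covers sets outside
  \<open>sets N\<close>.\<close>

lemma emeasure_completion_distr:
  assumes "f \<in> measurable M N" and "A \<in> sets (completion (distr M N f))"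
  shows "emeasure (completion (distr M N f)) A = emeasure M (f -` A \<inter> space M)"
  by (subst completion_distr[OF assms(1)])
    (intro emeasure_distr measurable_completion_distr assms)

text \<open>Preimages under \<open>f\<close> and \<open>g\<close> differ only inside a null set,
  which a complete measure can absorb. The codomain of \<open>f\<close> is assumed separately
  because almost everywhere equality says nothing about \<open>f\<close> on that null set.\<close>

lemma measurable_cong_AE_complete:
  assumes g: "g \<in> measurable M N" and f: "f \<in> space M \<rightarrow> space N"
    and ae: "AE x in M. f x = g x"
  shows "f \<in> measurable M N"
proof (rule measurableI)
  fix A assume "A \<in> sets N"
  show "f -` A \<inter> space M \<in> sets M"
  proof (rule in_sets_AE)
    show "g -` A \<inter> space M \<in> sets M"
      using g \<open>A \<in> sets N\<close> by (rule measurable_sets)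
    show "AE x in M. x \<in> g -` A \<inter> space M \<longleftrightarrow> x \<in> f -` A \<inter> space M"
      using ae by eventually_elim auto
  qed auto
qed (use f in auto)

end

lemma distr_restr_to_subalg:
  assumes "f \<in> measurable M K" and "subalgebra K L"
  shows "restr_to_subalg (distr M K f) L = distr M L f"
proof (rule measure_eqI)
  have sub: "subalgebra (distr M K f) L"
    using assms(2) by (simp add: subalgebra_def)
  then show "sets (restr_to_subalg (distr M K f) L) = sets (distr M L f)"
    by (simp add: sets_restr_to_subalg)
  fix A assume "A \<in> sets (restr_to_subalg (distr M K f) L)"
  then have A: "A \<in> sets L" by (simp add: sets_restr_to_subalg[OF sub])
  moreover have "f \<in> measurable M L"
    using measurable_mono[of L K M M] assms by (auto simp: subalgebra_def)
  ultimately show "emeasure (restr_to_subalg (distr M K f) L) A = emeasure (distr M L f) A"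
    using assms by (subst emeasure_restr_to_subalg[OF sub A])
      (auto simp: emeasure_distr subalgebra_def)
qed

text \<open>Removes the restriction built into \<open>completion_sets\<close> for measures that
  already live on the base \<sigma>-algebra.\<close>

lemma restr_to_subalg_same_sets:
  assumes "sets M = sets N"
  shows "restr_to_subalg M N = M"
  using assms by (simp add: restr_to_subalg_def measure_of_of_measure flip: assms)

section \<open>Fubini's theorem on the completed product\<close>

context pair_sigma_finite
begin

text \<open>The main part \<open>A\<close> of \<open>D\<close> lies in the uncompleted product and
  differs from \<open>D\<close> by a null set. By \<open>AE_pair\<close>, almost every section of
  \<open>D\<close> agrees almost everywhere with that of \<open>A\<close>, so Fubini for
  \<open>A\<close> transfers to \<open>D\<close>.\<close>

lemma
  assumes D: "D \<in> sets (completion (M1 \<Otimes>\<^sub>M M2))"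
  shows measurable_emeasure_completion_Pair:
      "(\<lambda>x. emeasure (completion M2) (Pair x -` D)) \<in> borel_measurable (completion M1)"
    and emeasure_completion_pair_measure:
      "(\<integral>\<^sup>+x. emeasure (completion M2) (Pair x -` D) \<partial>completion M1) =
       emeasure (completion (M1 \<Otimes>\<^sub>M M2)) D"
proof -
  define A where "A = main_part (M1 \<Otimes>\<^sub>M M2) D"
  have A: "A \<in> sets (M1 \<Otimes>\<^sub>M M2)"
    unfolding A_def using D by (rule main_part_sets)
  have D_sub: "D \<subseteq> space M1 \<times> space M2"
    using sets.sets_into_space[OF D] by (simp add: space_pair_measure)
  have "AE p in M1 \<Otimes>\<^sub>M M2. p \<in> A \<longleftrightarrow> p \<in> D"
    unfolding A_def using D by (rule AE_in_main_part)
  from AE_pair[OF this]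
  have ae: "AE x in M1. emeasure (completion M2) (Pair x -` D) = emeasure M2 (Pair x -` A)"
  proof eventually_elim
    case (elim x)
    have Ax: "Pair x -` A \<in> sets M2"
      using A by (rule sets_Pair1)
    have ae: "AE y in completion M2. y \<in> Pair x -` A \<longleftrightarrow> y \<in> Pair x -` D"
      using AE_completion[OF elim] by simp
    have "Pair x -` D \<in> sets (completion M2)"
      using ae Ax D_sub by (intro completion.in_sets_AE[OF ae]) auto
    then have "emeasure (completion M2) (Pair x -` D) = emeasure (completion M2) (Pair x -` A)"
      using ae Ax by (intro emeasure_eq_AE) auto
    then show ?case using Ax by simp
  qed
  have meas: "(\<lambda>x. emeasure M2 (Pair x -` A)) \<in> borel_measurable M1"
    using A by (rule M2.measurable_emeasure_Pair)
  show "(\<lambda>x. emeasure (completion M2) (Pair x -` D)) \<in> borel_measurable (completion M1)"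
    \<comment> \<open>For exceptional \<open>x\<close> the section of \<open>D\<close> may be
      non-measurable, and \<open>emeasure\<close> then has the default value 0. These
      \<open>x\<close> form a null set, so completeness of the first factor hides them.\<close>
    using measurable_completion[OF meas] _ AE_completion[OF ae]
    by (rule completion.measurable_cong_AE_complete) simp
  have "(\<integral>\<^sup>+x. emeasure (completion M2) (Pair x -` D) \<partial>completion M1) =
    (\<integral>\<^sup>+x. emeasure M2 (Pair x -` A) \<partial>M1)"
    unfolding nn_integral_completion using ae by (rule nn_integral_cong_AE)
  also have "\<dots> = emeasure (M1 \<Otimes>\<^sub>M M2) A"
    using A by (rule M2.emeasure_pair_measure_alt[symmetric])
  also have "\<dots> = emeasure (completion (M1 \<Otimes>\<^sub>M M2)) D"
    unfolding A_def using D by simp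
  finally show "(\<integral>\<^sup>+x. emeasure (completion M2) (Pair x -` D) \<partial>completion M1) =
    emeasure (completion (M1 \<Otimes>\<^sub>M M2)) D" .
qed

text \<open>The statement for the other factor follows by pulling \<open>D\<close> back along the
  swap of coordinates and applying the previous result to \<open>M2\<close> and
  \<open>M1\<close>.\<close>

lemma
  assumes D: "D \<in> sets (completion (M1 \<Otimes>\<^sub>M M2))"
  shows measurable_emeasure_completion_Pair2:
      "(\<lambda>y. emeasure (completion M1) ((\<lambda>x. (x, y)) -` D)) \<in> borel_measurable (completion M2)"
    and emeasure_completion_pair_measure2:
      "(\<integral>\<^sup>+y. emeasure (completion M1) ((\<lambda>x. (x, y)) -` D) \<partial>completion M2) =
       emeasure (completion (M1 \<Otimes>\<^sub>M M2)) D"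
proof -
  interpret Q: pair_sigma_finite M2 M1 ..
  let ?swap = "\<lambda>(x, y). (y, x)"
  have swap: "?swap \<in> measurable (completion (M2 \<Otimes>\<^sub>M M1)) (M1 \<Otimes>\<^sub>M M2)"
    by (intro measurable_completion measurable_pair_swap')
  \<comment> \<open>Identifies the push-forward under the swap, so that the general facts on
    completed push-forwards speak about \<open>completion (M1 \<Otimes>\<^sub>M M2)\<close>.\<close>
  have eq: "distr (completion (M2 \<Otimes>\<^sub>M M1)) (M1 \<Otimes>\<^sub>M M2) ?swap = M1 \<Otimes>\<^sub>M M2"
    by (simp add: distr_completion measurable_pair_swap' flip: distr_pair_swap)
  define D' where "D' = ?swap -` D \<inter> space (completion (M2 \<Otimes>\<^sub>M M1))"
  have D': "D' \<in> sets (completion (M2 \<Otimes>\<^sub>M M1))"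
    unfolding D'_def
    using completion.measurable_completion_distr[OF swap, unfolded eq] D
    by (rule measurable_sets)
  have "D \<subseteq> space M1 \<times> space M2"
    using sets.sets_into_space[OF D] by (simp add: space_pair_measure)
  then have sec: "Pair y -` D' = (\<lambda>x. (x, y)) -` D" for y
    by (auto simp: D'_def space_pair_measure)
  show "(\<lambda>y. emeasure (completion M1) ((\<lambda>x. (x, y)) -` D)) \<in> borel_measurable (completion M2)"
    using Q.measurable_emeasure_completion_Pair[OF D'] by (simp add: sec)
  have "emeasure (completion (M1 \<Otimes>\<^sub>M M2)) D = emeasure (completion (M2 \<Otimes>\<^sub>M M1)) D'"
    using completion.emeasure_completion_distr[OF swap, unfolded eq, OF D]
    by (simp only: D'_def)
  then show "(\<integral>\<^sup>+y. emeasure (completion M1) ((\<lambda>x. (x, y)) -` D) \<partial>completion M2) =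
    emeasure (completion (M1 \<Otimes>\<^sub>M M2)) D"
    using Q.emeasure_completion_pair_measure[OF D'] by (simp only: sec)
qed

end


section \<open>The sample space of a product-stable set of measures\<close>

text \<open>A map measurable for the completed \<sigma>-algebra need not be measurable for
  \<open>P\<close> itself; hence \<open>pushforward\<close> uses
  \<open>completion P\<close>.\<close>

locale product_stable_measures =
  fixes B :: "'a measure" and \<Theta> :: "'a \<Rightarrow> 'a \<times> 'a" and PP :: "'a measure set"
  assumes nonempty: "space B \<noteq> {}"
    and iso: "measurable_iso B (B \<Otimes>\<^sub>M B) \<Theta>"
    and PP_prob: "PP \<subseteq> space (prob_algebra B)"
    and PP_nonempty: "PP \<noteq> {}"
    and pushforward: "\<And>P \<Phi>. P \<in> PP \<Longrightarrow> \<Phi> \<in> measurable (completion_space B PP) B \<Longrightarrow>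
      distr (completion P) B \<Phi> \<in> PP"
    and product: "\<And>P1 P2. P1 \<in> PP \<Longrightarrow> P2 \<in> PP \<Longrightarrow>
      distr (P1 \<Otimes>\<^sub>M P2) B (the_inv_into (space B) \<Theta>) \<in> PP"
begin

abbreviation "BO \<equiv> completion_space B PP"
abbreviation "Endo \<equiv> measurable_maps BO BO"
abbreviation "\<Theta>' \<equiv> the_inv_into (space B) \<Theta>"

section \<open>The \<sigma>-algebra \<open>BO\<close> and its measurable maps\<close>

lemma
  assumes "P \<in> PP"
  shows PP_prob_space: "prob_space P" and sets_PP: "sets P = sets B"
    and space_PP: "space P = space B"
proof -
  have "P \<in> space (prob_algebra B)"
    using assms PP_prob by blast
  then show "prob_space P" "sets P = sets B"
    by (simp_all add: space_prob_algebra)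
  then show "space P = space B"
    by (intro sets_eq_imp_space_eq)
qed

lemma
  shows sets_BO: "sets BO = (\<Inter>P\<in>PP. sets (completion P))"
    and space_BO: "space BO = space B"
proof -
  have sub: "subalgebra P B" if "P \<in> PP" for P
    using that by (simp add: subalgebra_def sets_PP space_PP)
  show "space BO = space B"
    using PP_nonempty sub by (rule space_completion_space)
  have "sets BO = completion_sets B PP"
    using PP_nonempty sub by (rule sets_completion_space)
  then show "sets BO = (\<Inter>P\<in>PP. sets (completion P))"
    by (simp add: completion_sets_def restr_to_subalg_same_sets sets_PP)
qed

lemma sets_BO_completion: "A \<in> sets BO \<Longrightarrow> P \<in> PP \<Longrightarrow> A \<in> sets (completion P)"
  by (auto simp: sets_BO)

lemma sets_B_BO: "A \<in> sets B \<Longrightarrow> A \<in> sets BO"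
  by (auto simp: sets_BO sets_PP)

lemma subalgebra_BO_B: "subalgebra BO B"
  by (auto simp: subalgebra_def space_BO sets_B_BO)

lemma measurable_B_BO: "f \<in> measurable B N \<Longrightarrow> f \<in> measurable BO N"
  using subalgebra_BO_B by (rule measurable_from_subalg)

lemma measurable_completion_BO:
  assumes "f \<in> measurable BO N" and "P \<in> PP"
  shows "f \<in> measurable (completion P) N"
proof (rule measurable_from_subalg[OF _ assms(1)])
  show "subalgebra (completion P) BO"
    using assms(2) by (auto simp: subalgebra_def space_BO space_PP sets_BO_completion)
qed

text \<open>Since \<open>sets BO\<close> is an intersection, preimages can be tested in one
  completed measure at a time, where the results on complete measures apply.\<close>

lemma measurable_BO_iff: "f \<in> measurable BO N \<longleftrightarrow> (\<forall>P\<in>PP. f \<in> measurable (completion P) N)"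
proof
  assume f: "\<forall>P\<in>PP. f \<in> measurable (completion P) N"
  show "f \<in> measurable BO N"
  proof (rule measurableI)
    show "f x \<in> space N" if "x \<in> space BO" for x
    proof -
      obtain P where "P \<in> PP" using PP_nonempty by blast
      then show ?thesis
        using f that by (auto simp: space_BO space_PP dest!: bspec measurable_space)
    qed
    show "f -` A \<inter> space BO \<in> sets BO" if "A \<in> sets N" for A
      unfolding sets_BO
    proof
      fix P assume "P \<in> PP"
      then show "f -` A \<inter> space BO \<in> sets (completion P)"
        using measurable_sets[of f "completion P" N A] f that by (simp add: space_BO space_PP)
    qed
  qed
qed (simp add: measurable_completion_BO)

text \<open>For each \<open>P\<close>, the map is measurable from \<open>completion P\<close> into
  the completion of its push-forward. That push-forward is again in \<open>PP\<close>, so its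
  completion contains all of \<open>sets BO\<close>. This is where closure under push-forwards
  enters.\<close>

lemma measurable_BO_BO:
  assumes f: "f \<in> measurable BO B"
  shows "f \<in> measurable BO BO"
  unfolding measurable_BO_iff
proof
  fix P assume P: "P \<in> PP"
  have fP: "f \<in> measurable (completion P) B"
    using f P by (rule measurable_completion_BO)
  let ?Q = "completion (distr (completion P) B f)"
  have "sets BO \<subseteq> sets ?Q" "space BO = space ?Q"
    using pushforward[OF P f] by (auto simp: space_BO sets_BO_completion)
  then show "f \<in> measurable (completion P) BO"
    using measurable_mono[of BO ?Q "completion P" "completion P"]
      completion.measurable_completion_distr[OF fP] by auto
qed

lemma measurable_BO_B_iff: "f \<in> measurable BO B \<longleftrightarrow> f \<in> measurable BO BO"
proof
  assume "f \<in> measurable BO BO"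
  then show "f \<in> measurable BO B"
    using measurable_mono[of B BO BO BO] subalgebra_BO_B by (auto simp: subalgebra_def)
qed (rule measurable_BO_BO)

text \<open>Membership in \<open>Endo\<close> is thereby reduced to measurability into the
  uncompleted \<open>B\<close>, where composition with \<Theta> and its inverse is
  available.\<close>

lemma EndoI:
  assumes "f \<in> measurable BO B"
  shows "(\<lambda>\<omega>\<in>space BO. f \<omega>) \<in> Endo"
proof -
  have f: "f \<in> measurable BO BO"
    using assms by (rule measurable_BO_BO)
  then have "(\<lambda>\<omega>\<in>space BO. f \<omega>) \<in> measurable BO BO"
    by (subst measurable_cong[of BO _ f]) simp_all
  then show ?thesis
    using measurable_space[OF f] by (auto simp: measurable_maps_def)
qed

lemma EndoD: "\<Phi> \<in> Endo \<Longrightarrow> \<Phi> \<in> measurable BO B"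
  by (simp add: measurable_maps_def measurable_BO_B_iff)

lemma Endo_extensional: "Endo \<subseteq> space BO \<rightarrow>\<^sub>E space BO"
  by (auto simp: measurable_maps_def)

lemma measurable_Pair_Endo:
  "\<Phi>1 \<in> Endo \<Longrightarrow> \<Phi>2 \<in> Endo \<Longrightarrow> (\<lambda>\<omega>. (\<Phi>1 \<omega>, \<Phi>2 \<omega>)) \<in> measurable BO (B \<Otimes>\<^sub>M B)"
  by (intro measurable_Pair EndoD)

section \<open>The square \<sigma>-algebra seen through \<Theta>\<close>

lemma
  shows measurable_\<Theta>: "\<Theta> \<in> measurable B (B \<Otimes>\<^sub>M B)"
    and measurable_\<Theta>': "\<Theta>' \<in> measurable (B \<Otimes>\<^sub>M B) B"
    and bij_\<Theta>: "bij_betw \<Theta> (space B) (space B \<times> space B)"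
  using iso by (simp_all add: measurable_iso_def space_pair_measure)

lemma \<Theta>_\<Theta>': "p \<in> space B \<times> space B \<Longrightarrow> \<Theta> (\<Theta>' p) = p"
  using bij_\<Theta> by (metis bij_betw_def f_the_inv_into_f)

lemma \<Theta>'_space: "p \<in> space B \<times> space B \<Longrightarrow> \<Theta>' p \<in> space B"
  using measurable_space[OF measurable_\<Theta>'] by (simp add: space_pair_measure)

lemma \<Theta>'_vimage:
  assumes "D \<subseteq> space B \<times> space B"
  shows "\<Theta>' -` {\<omega> \<in> space B. \<Theta> \<omega> \<in> D} \<inter> (space B \<times> space B) = D"
  using assms by (auto simp: \<Theta>_\<Theta>' \<Theta>'_space)

lemma Endo_\<Theta>:
  shows "(\<lambda>\<omega>\<in>space BO. fst (\<Theta> \<omega>)) \<in> Endo" and "(\<lambda>\<omega>\<in>space BO. snd (\<Theta> \<omega>)) \<in> Endo"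
  by (intro EndoI measurable_B_BO measurable_compose[OF measurable_\<Theta>] measurable_fst measurable_snd)+

lemma measurable_\<Theta>'_Endo:
  assumes "\<Phi>1 \<in> Endo" "\<Phi>2 \<in> Endo"
  shows "(\<lambda>\<omega>. \<Theta>' (\<Phi>1 \<omega>, \<Phi>2 \<omega>)) \<in> measurable BO B"
  using measurable_Pair_Endo[OF assms] measurable_\<Theta>' by (rule measurable_compose)

text \<open>The single test map \<Theta> replaces all pairs from \<open>Endo\<close>. Its two
  components form one such pair; conversely, every pair factors as \<Theta> after the map \<omega>
  \<mapsto> \<open>\<Theta>' (\<Phi>1 \<omega>, \<Phi>2 \<omega>)\<close>, which is measurable from
  \<open>BO\<close> to \<open>BO\<close>.\<close>

lemma square_sets_iff:
  "D \<in> square_sets Endo BO \<longleftrightarrow> D \<subseteq> space B \<times> space B \<and> {\<omega> \<in> space B. \<Theta> \<omega> \<in> D} \<in> sets BO"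
proof (intro iffI conjI)
  assume D: "D \<in> square_sets Endo BO"
  then show "D \<subseteq> space B \<times> space B"
    by (simp add: square_sets_def space_BO)
  have "{\<omega> \<in> space BO. ((\<lambda>\<omega>\<in>space BO. fst (\<Theta> \<omega>)) \<omega>, (\<lambda>\<omega>\<in>space BO. snd (\<Theta> \<omega>)) \<omega>) \<in> D} \<in> sets BO"
    using D Endo_\<Theta> unfolding square_sets_def by blast
  then show "{\<omega> \<in> space B. \<Theta> \<omega> \<in> D} \<in> sets BO"
    by (simp add: space_BO cong: conj_cong)
next
  assume D: "D \<subseteq> space B \<times> space B \<and> {\<omega> \<in> space B. \<Theta> \<omega> \<in> D} \<in> sets BO"
  have "{\<omega> \<in> space BO. (\<Phi>1 \<omega>, \<Phi>2 \<omega>) \<in> D} \<in> sets BO" if \<Phi>: "\<Phi>1 \<in> Endo" "\<Phi>2 \<in> Endo" for \<Phi>1 \<Phi>2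
  proof -
    have "(\<Phi>1 \<omega>, \<Phi>2 \<omega>) \<in> D \<longleftrightarrow> \<Theta>' (\<Phi>1 \<omega>, \<Phi>2 \<omega>) \<in> {\<omega> \<in> space B. \<Theta> \<omega> \<in> D}"
      if "\<omega> \<in> space BO" for \<omega>
    proof -
      have p: "(\<Phi>1 \<omega>, \<Phi>2 \<omega>) \<in> space B \<times> space B"
        using measurable_space[OF measurable_Pair_Endo[OF \<Phi>] that]
        by (simp only: space_pair_measure)
      show ?thesis
        by (simp only: mem_Collect_eq \<Theta>_\<Theta>'[OF p] \<Theta>'_space[OF p] simp_thms)
    qed
    then have "{\<omega> \<in> space BO. (\<Phi>1 \<omega>, \<Phi>2 \<omega>) \<in> D} =
      (\<lambda>\<omega>. \<Theta>' (\<Phi>1 \<omega>, \<Phi>2 \<omega>)) -` {\<omega> \<in> space B. \<Theta> \<omega> \<in> D} \<inter> space BO"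
      by blast
    also have "\<dots> \<in> sets BO"
      using D by (intro measurable_sets[OF measurable_BO_BO[OF measurable_\<Theta>'_Endo[OF \<Phi>]]]) (rule conjunct2)
    finally show ?thesis .
  qed
  then show "D \<in> square_sets Endo BO"
    using D by (simp add: square_sets_def space_BO)
qed

text \<open>The image of the product measure under \<open>\<Theta>'\<close> belongs to
  \<open>PP\<close> by \<open>product\<close>, so its completion measures the set of \<omega> with
  \<Theta> \<omega> in \<open>D\<close>. Pulling that set back along \<open>\<Theta>'\<close>
  returns \<open>D\<close>.\<close>

lemma
  assumes D: "D \<in> square_sets Endo BO" and P: "P1 \<in> PP" "P2 \<in> PP"
  shows square_sets_completion: "D \<in> sets (completion (P1 \<Otimes>\<^sub>M P2))"
    and emeasure_square_sets: "emeasure (completion (distr (P1 \<Otimes>\<^sub>M P2) B \<Theta>')) {\<omega> \<in> space B. \<Theta> \<omega> \<in> D} =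
      emeasure (completion (P1 \<Otimes>\<^sub>M P2)) D"
proof -
  let ?M = "P1 \<Otimes>\<^sub>M P2" and ?E = "{\<omega> \<in> space B. \<Theta> \<omega> \<in> D}"
  have "sets ?M = sets (B \<Otimes>\<^sub>M B)"
    using P by (intro sets_pair_measure_cong sets_PP)
  then have m: "\<Theta>' \<in> measurable ?M B"
    using measurable_\<Theta>' by (simp cong: measurable_cong_sets)
  then have mc: "\<Theta>' \<in> measurable (completion ?M) B"
    by (rule measurable_completion)
  have eq: "distr (completion ?M) B \<Theta>' = distr ?M B \<Theta>'"
    using m by (rule distr_completion)
  have E: "?E \<in> sets (completion (distr ?M B \<Theta>'))"
    using D product[OF P] by (simp add: square_sets_iff sets_BO_completion)
  have vimage: "\<Theta>' -` ?E \<inter> space (completion ?M) = D"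
    using D P \<Theta>'_vimage[of D] by (simp add: square_sets_iff space_pair_measure space_PP)
  show "D \<in> sets (completion ?M)"
    using measurable_sets[OF completion.measurable_completion_distr[OF mc, unfolded eq] E]
    by (simp only: vimage)
  show "emeasure (completion (distr ?M B \<Theta>')) ?E = emeasure (completion ?M) D"
    using completion.emeasure_completion_distr[OF mc, unfolded eq, OF E] by (simp only: vimage)
qed

lemma PP_pair_sigma_finite:
  assumes "P1 \<in> PP" "P2 \<in> PP"
  shows "pair_sigma_finite P1 P2"
  using assms by (intro pair_sigma_finite.intro prob_space_imp_sigma_finite PP_prob_space)

lemma
  assumes "D \<in> square_sets Endo BO" "P1 \<in> PP" "P2 \<in> PP"
  shows square_sets_integral1: "(\<integral>\<^sup>+\<omega>1. emeasure (completion P2) {\<omega>2. (\<omega>1, \<omega>2) \<in> D} \<partial>completion P1) =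
      emeasure (completion (P1 \<Otimes>\<^sub>M P2)) D"
    and square_sets_integral2: "(\<integral>\<^sup>+\<omega>2. emeasure (completion P1) {\<omega>1. (\<omega>1, \<omega>2) \<in> D} \<partial>completion P2) =
      emeasure (completion (P1 \<Otimes>\<^sub>M P2)) D"
    and square_sets_measurable: "(\<lambda>\<omega>2. emeasure (completion P1) {\<omega>1. (\<omega>1, \<omega>2) \<in> D}) \<in>
      borel_measurable (completion P2)"
  using pair_sigma_finite.emeasure_completion_pair_measure[OF PP_pair_sigma_finite square_sets_completion]
    pair_sigma_finite.emeasure_completion_pair_measure2[OF PP_pair_sigma_finite square_sets_completion]
    pair_sigma_finite.measurable_emeasure_completion_Pair2[OF PP_pair_sigma_finite square_sets_completion]
    assms
  by (simp_all add: vimage_def)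

section \<open>Sample space axioms and the Fubini property\<close>

lemma sample_space: "product_compatible_sample_space Endo BO (completion ` PP)"
proof
  show "space BO \<noteq> {}"
    using nonempty by (simp add: space_BO)
  show "(\<lambda>\<omega>\<in>space BO. \<omega>) \<in> Endo"
    by (intro EndoI) (simp add: measurable_BO_B_iff)
  show "(\<lambda>\<omega>\<in>space BO. c) \<in> Endo" if "c \<in> space BO" for c
    using that by (intro EndoI) (simp add: space_BO)
  show "compose (space BO) \<Phi> \<Psi> \<in> Endo" if "\<Phi> \<in> Endo" "\<Psi> \<in> Endo" for \<Phi> \<Psi>
    unfolding compose_def using that
    by (intro EndoI) (auto simp: measurable_maps_def measurable_BO_B_iff intro: measurable_compose)
  show "\<Phi> \<in> measurable BO BO" if "\<Phi> \<in> Endo" for \<Phi>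
    using that by (simp add: measurable_maps_def)
  show "prob_space P \<and> space P = space BO" if "P \<in> completion ` PP" for P
    using that by (auto simp: space_BO space_PP prob_space.prob_space_completion PP_prob_space)
  show "\<Phi> -` D \<inter> space BO \<in> sets P"
    if "\<Phi> \<in> Endo" "P \<in> completion ` PP" "D \<in> sets BO" for \<Phi> P D
    using that measurable_sets[of \<Phi> BO BO D]
    by (auto simp: measurable_maps_def intro: sets_BO_completion)
  \<comment> \<open>Measurability over \<open>BO\<close> is tested at the completion of every member
    of \<open>PP\<close>, where it is Fubini for the product with that member.\<close>
  show "(\<lambda>\<omega>2. emeasure P {\<omega>1. (\<omega>1, \<omega>2) \<in> D}) \<in> borel_measurable BO"
    if "D \<in> square_sets Endo BO" "P \<in> completion ` PP" for D P
    using that by (auto simp: measurable_BO_iff intro!: square_sets_measurable)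
  show "\<exists>P\<in>completion ` PP. \<exists>\<Phi>1\<in>Endo. \<exists>\<Phi>2\<in>Endo. \<forall>D\<in>square_sets Endo BO.
      (\<integral>\<^sup>+\<omega>2. emeasure P1 {\<omega>1. (\<omega>1, \<omega>2) \<in> D} \<partial>P2) =
      emeasure P {\<omega> \<in> space BO. (\<Phi>1 \<omega>, \<Phi>2 \<omega>) \<in> D}"
    if P12: "P1 \<in> completion ` PP" "P2 \<in> completion ` PP" for P1 P2
  proof -
    obtain Q1 Q2 where Q: "Q1 \<in> PP" "Q2 \<in> PP" "P1 = completion Q1" "P2 = completion Q2"
      using P12 by blast
    \<comment> \<open>The witnesses are the product measure transported to \<Omega> by
      \<open>\<Theta>'\<close> and the two components of \<Theta>; together the components give back
      \<Theta>, so the right-hand side is the completed product measure of \<open>D\<close>.\<close>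
    let ?P = "completion (distr (Q1 \<Otimes>\<^sub>M Q2) B \<Theta>')"
    have "(\<integral>\<^sup>+\<omega>2. emeasure P1 {\<omega>1. (\<omega>1, \<omega>2) \<in> D} \<partial>P2) =
      emeasure ?P {\<omega> \<in> space BO.
        ((\<lambda>\<omega>\<in>space BO. fst (\<Theta> \<omega>)) \<omega>, (\<lambda>\<omega>\<in>space BO. snd (\<Theta> \<omega>)) \<omega>) \<in> D}"
      if D: "D \<in> square_sets Endo BO" for D
    proof -
      have "{\<omega> \<in> space BO. ((\<lambda>\<omega>\<in>space BO. fst (\<Theta> \<omega>)) \<omega>, (\<lambda>\<omega>\<in>space BO. snd (\<Theta> \<omega>)) \<omega>) \<in> D} =
        {\<omega> \<in> space B. \<Theta> \<omega> \<in> D}"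
        by (auto simp: space_BO)
      then show ?thesis
        using square_sets_integral2[OF D Q(1,2)] emeasure_square_sets[OF D Q(1,2)]
        by (simp only: Q)
    qed
    then show ?thesis
      using Endo_\<Theta> product[OF Q(1,2)] by blast
  qed
qed (use PP_nonempty Endo_extensional in auto)

text \<open>Both iterated integrals equal the completed product measure of \<open>D\<close>.\<close>

lemma fubini: "fubini_property Endo BO (completion ` PP)"
  by (auto simp: fubini_property_def square_sets_integral1 square_sets_integral2)

section \<open>The quasi-measurable isomorphism of \<Omega> with its square\<close>

lemma quasi_measurable_iso_\<Theta>:
  "quasi_measurable_iso (space BO) Endo (space BO) Endo
     (space BO \<times> space BO) (prod_maps (space BO) Endo Endo) \<Theta>"
proof -
  interpret S: product_compatible_sample_space Endo BO "completion ` PP"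
    by (rule sample_space)
  have Endo_space: "\<Phi> \<omega> \<in> space BO" if "\<Phi> \<in> Endo" "\<omega> \<in> space BO" for \<Phi> \<omega>
    using Endo_extensional that by (auto simp: PiE_iff subset_iff)
  have \<Theta>_space: "\<Theta> \<in> space BO \<rightarrow> space BO \<times> space BO"
    using bij_\<Theta> by (auto simp: bij_betw_def space_BO)
  \<comment> \<open>The components need only be measurable into \<open>B\<close>; restricting them
    to the space supplies the extensional witnesses that \<open>prod_maps\<close> asks for.\<close>
  have prod_mapsI: "(\<lambda>\<omega>\<in>space BO. (\<alpha> \<omega>, \<beta> \<omega>)) \<in> prod_maps (space BO) Endo Endo"
    if "\<alpha> \<in> measurable BO B" "\<beta> \<in> measurable BO B" for \<alpha> \<beta>
    unfolding prod_maps_def using EndoI[OF that(1)] EndoI[OF that(2)]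
    by (intro CollectI exI[of _ "restrict \<alpha> (space BO)"] exI[of _ "restrict \<beta> (space BO)"])
      (auto simp: fun_eq_iff)
  have "quasi_measurable_space (space BO) Endo (space BO) Endo"
    using Endo_extensional S.constants S.composition
    by (simp add: quasi_measurable_space_def)
  moreover have "quasi_measurable_space (space BO) Endo
    (space BO \<times> space BO) (prod_maps (space BO) Endo Endo)"
    unfolding quasi_measurable_space_def
  proof (intro conjI ballI)
    show "prod_maps (space BO) Endo Endo \<subseteq> space BO \<rightarrow>\<^sub>E space BO \<times> space BO"
      by (auto simp: prod_maps_def Endo_space)
    show "(\<lambda>\<omega>\<in>space BO. x) \<in> prod_maps (space BO) Endo Endo"
      if "x \<in> space BO \<times> space BO" for x
      using prod_mapsI[of "\<lambda>_. fst x" "\<lambda>_. snd x"] that by (auto simp: space_BO)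
    fix \<gamma> \<Phi> assume \<gamma>: "\<gamma> \<in> prod_maps (space BO) Endo Endo" and \<Phi>: "\<Phi> \<in> Endo"
    then obtain \<alpha> \<beta> where ab: "\<alpha> \<in> Endo" "\<beta> \<in> Endo" "\<gamma> = (\<lambda>\<omega>\<in>space BO. (\<alpha> \<omega>, \<beta> \<omega>))"
      by (auto simp: prod_maps_def)
    have "compose (space BO) \<gamma> \<Phi> = (\<lambda>\<omega>\<in>space BO. (\<alpha> (\<Phi> \<omega>), \<beta> (\<Phi> \<omega>)))"
      using \<Phi> ab by (auto simp: compose_def fun_eq_iff Endo_space)
    also have "\<dots> \<in> prod_maps (space BO) Endo Endo"
      by (intro prod_mapsI measurable_compose[OF S.measurable[OF \<Phi>] EndoD] ab)
    finally show "compose (space BO) \<gamma> \<Phi> \<in> prod_maps (space BO) Endo Endo" .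
  qed
  moreover have "quasi_measurable (space BO) (space BO) Endo
    (space BO \<times> space BO) (prod_maps (space BO) Endo Endo) \<Theta>"
    unfolding quasi_measurable_def
  proof (intro conjI ballI)
    fix \<alpha> assume "\<alpha> \<in> Endo"
    then have "(\<lambda>\<omega>. \<Theta> (\<alpha> \<omega>)) \<in> measurable BO (B \<Otimes>\<^sub>M B)"
      by (intro measurable_compose[OF EndoD measurable_\<Theta>])
    then show "compose (space BO) \<Theta> \<alpha> \<in> prod_maps (space BO) Endo Endo"
      using prod_mapsI[of "\<lambda>\<omega>. fst (\<Theta> (\<alpha> \<omega>))" "\<lambda>\<omega>. snd (\<Theta> (\<alpha> \<omega>))"]
      by (simp add: compose_def measurable_compose[OF _ measurable_fst]
          measurable_compose[OF _ measurable_snd])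
  qed (rule \<Theta>_space)
  moreover have "quasi_measurable (space BO) (space BO \<times> space BO)
    (prod_maps (space BO) Endo Endo) (space BO) Endo (the_inv_into (space BO) \<Theta>)"
    unfolding quasi_measurable_def
  proof (intro conjI ballI)
    fix \<gamma> assume "\<gamma> \<in> prod_maps (space BO) Endo Endo"
    then obtain \<alpha> \<beta> where ab: "\<alpha> \<in> Endo" "\<beta> \<in> Endo" "\<gamma> = (\<lambda>\<omega>\<in>space BO. (\<alpha> \<omega>, \<beta> \<omega>))"
      by (auto simp: prod_maps_def)
    then have "compose (space BO) \<Theta>' \<gamma> = (\<lambda>\<omega>\<in>space BO. \<Theta>' (\<alpha> \<omega>, \<beta> \<omega>))"
      by (auto simp: compose_def fun_eq_iff)
    then show "compose (space BO) (the_inv_into (space BO) \<Theta>) \<gamma> \<in> Endo"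
      using EndoI[OF measurable_\<Theta>'_Endo[OF ab(1,2)]] by (simp add: space_BO)
  qed (use \<Theta>'_space in \<open>auto simp: space_BO\<close>)
  ultimately show ?thesis
    using bij_\<Theta> by (simp add: quasi_measurable_iso_def space_BO)
qed

section \<open>Completeness with respect to the push-forwards\<close>

lemma complete_wrt_pushforwards: "complete_wrt BO (pushforwards Endo BO (completion ` PP))"
  unfolding complete_wrt_def
proof
  have restr: "restr_to_subalg (distr P BO \<Phi>) BO = distr P BO \<Phi>" for P :: "'a measure" and \<Phi>
    by (rule restr_to_subalg_same_sets) simp
  show "sets BO \<subseteq> completion_sets BO (pushforwards Endo BO (completion ` PP))"
    by (auto simp: completion_sets_def pushforwards_def restr)
  show "completion_sets BO (pushforwards Endo BO (completion ` PP)) \<subseteq> sets BO"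
    unfolding sets_BO
  proof (intro subsetI INT_I)
    fix A P
    assume A: "A \<in> completion_sets BO (pushforwards Endo BO (completion ` PP))" and P: "P \<in> PP"
    \<comment> \<open>For the nontrivial inclusion, each \<open>P\<close> is tested against its
      push-forward along the identity: a set in the completion of that push-forward is its own
      preimage, hence lies in \<open>completion P\<close>.\<close>
    let ?id = "\<lambda>\<omega>\<in>space BO. \<omega>"
    have id: "?id \<in> Endo"
      by (rule product_compatible_sample_space.identity[OF sample_space])
    then have "?id \<in> measurable (completion P) BO"
      using P by (intro measurable_completion_BO) (simp_all add: measurable_maps_def)
    note m = completion.measurable_completion_distr[OF this]
    have "distr (completion P) BO ?id \<in> pushforwards Endo BO (completion ` PP)"
      using id P by (auto simp: pushforwards_def)
    then have "A \<in> sets (completion (restr_to_subalg (distr (completion P) BO ?id) BO))"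
      using A unfolding completion_sets_def by blast
    then have A': "A \<in> sets (completion (distr (completion P) BO ?id))"
      unfolding restr .
    then have "A \<subseteq> space BO"
      using sets.sets_into_space by fastforce
    then have "?id -` A \<inter> space (completion P) = A"
      using P by (auto simp: space_PP space_BO)
    then show "A \<in> sets (completion P)"
      using measurable_sets[OF m A'] by simp
  qed
qed

section \<open>The square \<sigma>-algebra as a completion of the product\<close>

lemma subalgebra_square_space: "subalgebra (square_space Endo BO) (BO \<Otimes>\<^sub>M BO)"
proof -
  \<comment> \<open>Rectangles generate the product \<sigma>-algebra, and a pair of maps pulls a
    rectangle back to an intersection of two preimages.\<close>
  have "A \<times> C \<in> square_sets Endo BO" if "A \<in> sets BO" "C \<in> sets BO" for A C
  proof -
    have "{\<omega> \<in> space BO. (\<Phi>1 \<omega>, \<Phi>2 \<omega>) \<in> A \<times> C} \<in> sets BO"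
      if "\<Phi>1 \<in> Endo" "\<Phi>2 \<in> Endo" for \<Phi>1 \<Phi>2
    proof -
      have "{\<omega> \<in> space BO. (\<Phi>1 \<omega>, \<Phi>2 \<omega>) \<in> A \<times> C} =
        (\<Phi>1 -` A \<inter> space BO) \<inter> (\<Phi>2 -` C \<inter> space BO)"
        by auto
      then show ?thesis
        using that \<open>A \<in> sets BO\<close> \<open>C \<in> sets BO\<close>
        by (auto simp: measurable_maps_def intro: measurable_sets)
    qed
    then show ?thesis
      using that[THEN sets.sets_into_space] by (auto simp: square_sets_def)
  qed
  then have "sets (BO \<Otimes>\<^sub>M BO) \<subseteq> square_sets Endo BO"
    unfolding sets_pair_measure
    by (intro sigma_algebra.sigma_sets_subset[OF sigma_algebra_square_sets[OF Endo_extensional]]) blast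
  then show ?thesis
    by (simp add: subalgebra_def space_pair_measure sets_square_space[OF Endo_extensional]
        space_square_space[OF Endo_extensional])
qed

lemma measurable_square_space:
  assumes "\<Phi>1 \<in> Endo" "\<Phi>2 \<in> Endo"
  shows "(\<lambda>\<omega>. (\<Phi>1 \<omega>, \<Phi>2 \<omega>)) \<in> measurable BO (square_space Endo BO)"
proof (rule measurableI)
  show "(\<Phi>1 \<omega>, \<Phi>2 \<omega>) \<in> space (square_space Endo BO)" if "\<omega> \<in> space BO" for \<omega>
    using assms that Endo_extensional
    by (auto simp: space_square_space[OF Endo_extensional] PiE_iff subset_iff)
  show "(\<lambda>\<omega>. (\<Phi>1 \<omega>, \<Phi>2 \<omega>)) -` D \<inter> space BO \<in> sets BO"
    if "D \<in> sets (square_space Endo BO)" for D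
  proof -
    have "{\<omega> \<in> space BO. (\<Phi>1 \<omega>, \<Phi>2 \<omega>) \<in> D} \<in> sets BO"
      using that assms by (simp add: sets_square_space[OF Endo_extensional] square_sets_def)
    then show ?thesis
      by (simp add: vimage_def Int_def conj_commute)
  qed
qed

text \<open>Restricting a push-forward on the square \<sigma>-algebra to the product
  \<sigma>-algebra is the same as pushing forward to the smaller one directly.\<close>

lemma completion_sets_square_pushforwards:
  "completion_sets (BO \<Otimes>\<^sub>M BO) (square_pushforwards Endo BO (completion ` PP)) =
   (\<Inter>P\<in>PP. \<Inter>\<Phi>1\<in>Endo. \<Inter>\<Phi>2\<in>Endo.
     sets (completion (distr (completion P) (BO \<Otimes>\<^sub>M BO) (\<lambda>\<omega>. (\<Phi>1 \<omega>, \<Phi>2 \<omega>)))))"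
proof -
  have "restr_to_subalg (distr (completion P) (square_space Endo BO) (\<lambda>\<omega>. (\<Phi>1 \<omega>, \<Phi>2 \<omega>))) (BO \<Otimes>\<^sub>M BO) =
    distr (completion P) (BO \<Otimes>\<^sub>M BO) (\<lambda>\<omega>. (\<Phi>1 \<omega>, \<Phi>2 \<omega>))"
    if "P \<in> PP" "\<Phi>1 \<in> Endo" "\<Phi>2 \<in> Endo" for P \<Phi>1 \<Phi>2
    using that by (intro distr_restr_to_subalg measurable_completion_BO measurable_square_space
        subalgebra_square_space)
  note eq = this
  have "square_pushforwards Endo BO (completion ` PP) =
    (\<Union>P\<in>PP. \<Union>\<Phi>1\<in>Endo. \<Union>\<Phi>2\<in>Endo.
      {distr (completion P) (square_space Endo BO) (\<lambda>\<omega>. (\<Phi>1 \<omega>, \<Phi>2 \<omega>))})"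
    by (auto simp: square_pushforwards_def)
  then show ?thesis
    by (simp add: completion_sets_def eq cong: INF_cong)
qed

text \<open>For the first inclusion, \<open>\<Theta>'\<close> sends the push-forward
  \<open>R\<close> of \<open>P\<close> under a pair to another member of \<open>PP\<close>, so
  \<open>D\<close> is recovered in \<open>completion R\<close> by pulling back along
  \<open>\<Theta>'\<close>. For the second, a pair is measurable from \<open>completion P\<close>
  into the completion of its own push-forward; intersecting over \<open>P\<close> puts the preimage
  of \<open>D\<close> in \<open>BO\<close>.\<close>

lemma square_sets_eq_completion_sets:
  "square_sets Endo BO = completion_sets (BO \<Otimes>\<^sub>M BO) (square_pushforwards Endo BO (completion ` PP))"
proof
  show "square_sets Endo BO \<subseteq>
    completion_sets (BO \<Otimes>\<^sub>M BO) (square_pushforwards Endo BO (completion ` PP))"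
    unfolding completion_sets_square_pushforwards
  proof (intro subsetI INT_I)
    fix D P \<Phi>1 \<Phi>2
    assume D: "D \<in> square_sets Endo BO" and P: "P \<in> PP" and \<Phi>: "\<Phi>1 \<in> Endo" "\<Phi>2 \<in> Endo"
    let ?E = "{\<omega> \<in> space B. \<Theta> \<omega> \<in> D}"
    define R where "R = distr (completion P) (BO \<Otimes>\<^sub>M BO) (\<lambda>\<omega>. (\<Phi>1 \<omega>, \<Phi>2 \<omega>))"
    have pair: "(\<lambda>\<omega>. (\<Phi>1 \<omega>, \<Phi>2 \<omega>)) \<in> measurable (completion P) (BO \<Otimes>\<^sub>M BO)"
      using \<Phi> P by (intro measurable_completion_BO measurable_Pair) (simp_all add: measurable_maps_def)
    \<comment> \<open>This is the identity on pairs, written so that the passage from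
      \<open>BO\<close> to the coarser \<open>B\<close> can be made in each coordinate.\<close>
    have "(\<lambda>p. (fst p, snd p)) \<in> measurable (BO \<Otimes>\<^sub>M BO) (B \<Otimes>\<^sub>M B)"
      by (intro measurable_Pair measurable_compose[OF measurable_fst]
          measurable_compose[OF measurable_snd]) (simp_all add: measurable_BO_B_iff)
    from measurable_compose[OF this measurable_\<Theta>']
    have \<Theta>'_BO: "\<Theta>' \<in> measurable (BO \<Otimes>\<^sub>M BO) B"
      by simp
    then have "\<Theta>' \<in> measurable R B"
      by (simp add: R_def)
    then have \<Theta>'_R: "\<Theta>' \<in> measurable (completion R) B"
      by (rule measurable_completion)
    have "distr (completion R) B \<Theta>' = distr R B \<Theta>'"
      using \<open>\<Theta>' \<in> measurable R B\<close> by (rule distr_completion)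
    \<comment> \<open>Composing first gives a single map from \<Omega> to \<Omega>, to which closure
      under push-forwards applies.\<close>
    also have "\<dots> = distr (completion P) B (\<lambda>\<omega>. \<Theta>' (\<Phi>1 \<omega>, \<Phi>2 \<omega>))"
      unfolding R_def using \<Theta>'_BO pair by (simp add: distr_distr comp_def)
    also have "\<dots> \<in> PP"
      using P measurable_\<Theta>'_Endo[OF \<Phi>] by (rule pushforward)
    finally have "?E \<in> sets (completion (distr (completion R) B \<Theta>'))"
      using D by (simp add: square_sets_iff sets_BO_completion)
    with completion.measurable_completion_distr[OF \<Theta>'_R]
    have "\<Theta>' -` ?E \<inter> space (completion R) \<in> sets (completion R)"
      by (rule measurable_sets)
    moreover have "\<Theta>' -` ?E \<inter> space (completion R) = D"
      using D \<Theta>'_vimage[of D] by (simp add: R_def square_sets_iff space_pair_measure space_BO)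
    ultimately show "D \<in> sets (completion R)"
      by simp
  qed
next
  show "completion_sets (BO \<Otimes>\<^sub>M BO) (square_pushforwards Endo BO (completion ` PP)) \<subseteq>
    square_sets Endo BO"
  proof
    fix D assume "D \<in> completion_sets (BO \<Otimes>\<^sub>M BO) (square_pushforwards Endo BO (completion ` PP))"
    then have D: "D \<in> sets (completion (distr (completion P) (BO \<Otimes>\<^sub>M BO) (\<lambda>\<omega>. (\<Phi>1 \<omega>, \<Phi>2 \<omega>))))"
      if "P \<in> PP" "\<Phi>1 \<in> Endo" "\<Phi>2 \<in> Endo" for P \<Phi>1 \<Phi>2
      using that unfolding completion_sets_square_pushforwards by blast
    obtain P where "P \<in> PP"
      using PP_nonempty by blast
    from sets.sets_into_space[OF D[OF this Endo_\<Theta>]]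
    have "D \<subseteq> space BO \<times> space BO"
      by (simp add: space_pair_measure)
    moreover have "{\<omega> \<in> space BO. (\<Phi>1 \<omega>, \<Phi>2 \<omega>) \<in> D} \<in> sets BO"
      if \<Phi>: "\<Phi>1 \<in> Endo" "\<Phi>2 \<in> Endo" for \<Phi>1 \<Phi>2
      unfolding sets_BO
    proof
      fix P assume P: "P \<in> PP"
      have "(\<lambda>\<omega>. (\<Phi>1 \<omega>, \<Phi>2 \<omega>)) \<in> measurable (completion P) (BO \<Otimes>\<^sub>M BO)"
        using \<Phi> P by (intro measurable_completion_BO measurable_Pair) (simp_all add: measurable_maps_def)
      from measurable_sets[OF completion.measurable_completion_distr[OF this] D[OF P \<Phi>]]
      show "{\<omega> \<in> space BO. (\<Phi>1 \<omega>, \<Phi>2 \<omega>) \<in> D} \<in> sets (completion P)"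
        using P by (simp add: vimage_def Int_def conj_commute space_BO space_PP)
    qed
    ultimately show "D \<in> square_sets Endo BO"
      by (simp add: square_sets_def)
  qed
qed

end

theorem theorem6p2:
  fixes B :: "'a measure"
    and \<Theta> :: "'a \<Rightarrow> 'a \<times> 'a"
    and PP :: "'a measure set"
  defines "BO \<equiv> completion_space B PP"
  defines "Endo \<equiv> measurable_maps BO BO"
  defines "PC \<equiv> completion ` PP"
  assumes nonempty: "space B \<noteq> {}"
    and iso: "measurable_iso B (B \<Otimes>\<^sub>M B) \<Theta>"
    and PP_prob: "PP \<subseteq> space (prob_algebra B)"
    and PP_nonempty: "PP \<noteq> {}"
    and pushforward: "\<And>P \<Phi>. P \<in> PP \<Longrightarrow> \<Phi> \<in> measurable BO B \<Longrightarrow> distr (completion P) B \<Phi> \<in> PP"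
    and product: "\<And>P1 P2. P1 \<in> PP \<Longrightarrow> P2 \<in> PP \<Longrightarrow>
      distr (P1 \<Otimes>\<^sub>M P2) B (the_inv_into (space B) \<Theta>) \<in> PP"
  shows "product_compatible_sample_space Endo BO PC \<and>
    fubini_property Endo BO PC \<and>
    (\<exists>f. quasi_measurable_iso (space BO) Endo
       (space BO) Endo (space BO \<times> space BO) (prod_maps (space BO) Endo Endo) f) \<and>
    complete_wrt BO (pushforwards Endo BO PC) \<and>
    measurable_maps BO B = measurable_maps BO BO \<and>
    measurable_maps BO BO = Endo \<and>
    square_sets Endo BO = completion_sets (BO \<Otimes>\<^sub>M BO) (square_pushforwards Endo BO PC)"
proof -
  interpret product_stable_measures B \<Theta> PP
    using nonempty iso PP_prob PP_nonempty pushforward product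
    unfolding BO_def by unfold_locales
  \<comment> \<open>The extensional parts agree as well, because completion does not change the
    underlying space.\<close>
  have "measurable_maps BO B = measurable_maps BO BO"
    unfolding BO_def by (auto simp: measurable_maps_def measurable_BO_B_iff space_BO)
  then show ?thesis
    using sample_space fubini quasi_measurable_iso_\<Theta> complete_wrt_pushforwards
      square_sets_eq_completion_sets
    unfolding Endo_def PC_def BO_def by blast
qed

end
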